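(* Let $H$ be a real Hilbert space and let $J:H\to\mathbb{R}$ be twice continuously Fréchet differentiable with a global minimizer $x^*\in H$. Suppose that for some constant $L>0$ $$\|J''(x)-J''(y)\|_{L(H)}\le L\|x-y\|,\quad x,y\in H.$$ Let $\xi\in H$ and suppose that $w\in H$ satisfies $x^*-\xi=J''(x^* )w$, that $L\|w\|<1$, and that $L\widehat C_0<2$, where $$\widehat C_0=\frac{1}{1-L\|w\|}\left(L\|w\|^2+\sqrt{L^2\|w\|^4+(1-L\|w\|)\left(4\|w\|^2+\tfrac{8}{3}L\|w\|^3\right)}\right).$$ For $\alpha>0$ let $u_\alpha$ denote the unique global minimizer on $H$ of $T_\alpha(x)=J(x)+\alpha\|x-\xi\|^2$. Fix $\bar\alpha>0$. Then there is a constant $C_3\ge 0$, independent of $\alpha$ and $\beta$, such that for all $0<\beta<\alpha\le\bar\alpha$ $$\|u_\alpha-u_\beta\|\le C_3\frac{\alpha-\beta}{\sqrt{\alpha}}.$$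
   Context: $\|\cdot\|$ is the norm of $H$ and $\|\cdot\|_{L(H)}$ is the operator norm on bounded linear operators on $H$. $J'(x)\in H$ is the gradient and $J''(x)\in L(H)$ the (self-adjoint) second Fréchet derivative, via the Riesz identification. Under the stated hypotheses the global minimizer $u_\alpha$ of $T_\alpha$ exists and is unique for every $\alpha>0$, and $\|u_\alpha-x^*\|\le\widehat C_0\alpha$. The constant $C_3$ may depend on $J$, $x^*$, $\xi$, $w$, $L$ and $\bar\alpha$. *)

theory Defs
  imports "HOL-Analysis.Analysis"
begin

definition tikhonov :: "('a::real_inner \<Rightarrow> real) \<Rightarrow> 'a \<Rightarrow> real \<Rightarrow> 'a \<Rightarrow> real" where
  "tikhonov J \<xi> \<alpha> x = J x + \<alpha> * (norm (x - \<xi>))\<^sup>2"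

(* A definite description: it denotes the intended point exactly when the
   global minimizer exists and is unique. *)
definition tikhonov_min :: "('a::real_inner \<Rightarrow> real) \<Rightarrow> 'a \<Rightarrow> real \<Rightarrow> 'a" where
  "tikhonov_min J \<xi> \<alpha> = (THE u. is_arg_min (tikhonov J \<xi> \<alpha>) (\<lambda>_. True) u)"

definition C0_hat :: "real \<Rightarrow> 'a::real_normed_vector \<Rightarrow> real" where
  "C0_hat L w = 1 / (1 - L * norm w) *
     (L * norm w ^ 2
      + sqrt (L ^ 2 * norm w ^ 4
              + (1 - L * norm w) * (4 * norm w ^ 2 + 8 / 3 * L * norm w ^ 3)))"

end

theory Submission
  imports Defs
begin

text \<open>Testing \<open>T\<^sub>\<alpha>(x)\<close> against \<open>T\<^sub>\<alpha>(x\<^sup>* - 2 \<alpha> w)\<close> confines every competitive point to the ball of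
  radius \<open>C\<^sub>0 \<alpha>\<close> about \<open>x\<^sup>*\<close>. There the Hessian of \<open>J\<close> is at least \<open>A - L C\<^sub>0 \<alpha>\<close> with
  \<open>A = J''(x\<^sup>*) \<ge> 0\<close>, so \<open>T\<^sub>\<alpha>\<close> is strongly convex on the ball with modulus \<open>(2 - L C\<^sub>0) \<alpha>\<close>, and the
  minimizer exists uniquely even though \<open>J\<close> need not be convex. Subtracting the optimality conditions
  for \<open>\<alpha>\<close> and \<open>\<beta>\<close> and testing with \<open>d = u\<^sub>\<alpha> - u\<^sub>\<beta>\<close> gives
  \<open>\<langle>A d, d\<rangle> + (2 - L C\<^sub>0) \<alpha> \<parallel>d\<parallel>\<^sup>2 \<le> - 2 (\<alpha> - \<beta>) \<langle>u\<^sub>\<beta> - x\<^sup>* + A w, d\<rangle>\<close>; keeping the term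
  \<open>\<langle>A d, d\<rangle>\<close> is what yields the rate \<open>(\<alpha> - \<beta>) / \<surd>\<alpha>\<close>.\<close>

section \<open>Scalar inequalities\<close>

text \<open>Multiply by \<open>a\<close> and complete the square. With
  \<open>a = 1 - L * norm w\<close>, \<open>b = L * norm w ^ 2\<close> and
  \<open>c = 4 * norm w ^ 2 + 8/3 * L * norm w ^ 3\<close> the factor of \<open>t\<close> becomes
  \<open>C0_hat L w\<close>.\<close>

lemma quadratic_root_bound:
  fixes a b c e t :: real
  assumes "0 < a" "0 < t" and le: "a * e\<^sup>2 \<le> 2 * (b * t) * e + c * t\<^sup>2"
  shows "e \<le> 1 / a * (b + sqrt (b\<^sup>2 + a * c)) * t"
proof -
  have "a * (a * e\<^sup>2) \<le> a * (2 * (b * t) * e + c * t\<^sup>2)"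
    using le \<open>0 < a\<close> by (intro mult_left_mono) auto
  then have "(a * e - b * t)\<^sup>2 \<le> (b\<^sup>2 + a * c) * t\<^sup>2"
    by (simp add: power2_eq_square algebra_simps)
  then have "a * e - b * t \<le> sqrt ((b\<^sup>2 + a * c) * t\<^sup>2)"
    by (rule real_le_rsqrt)
  also have "\<dots> = sqrt (b\<^sup>2 + a * c) * t"
    using \<open>0 < t\<close> by (simp add: real_sqrt_mult)
  finally have "a * e \<le> (b + sqrt (b\<^sup>2 + a * c)) * t"
    by (simp add: algebra_simps)
  then show ?thesis
    using \<open>0 < a\<close> by (simp add: field_simps)
qed

text \<open>Turns the remainder of a second difference into an expression symmetric in the two
  increments, so that both orders of differencing share one error bound.\<close>

lemma sum_powers_le_cube:
  fixes s t :: real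
  assumes "0 \<le> s" "0 \<le> t"
  shows "s\<^sup>2 * t / 2 + s * t\<^sup>2 / 2 + t ^ 3 / 3 \<le> (s + t) ^ 3"
proof -
  have "(s + t) ^ 3 = s ^ 3 + 3 * (s\<^sup>2 * t) + 3 * (s * t\<^sup>2) + t ^ 3"
    by (simp add: power2_eq_square power3_eq_cube algebra_simps)
  moreover have "0 \<le> s ^ 3" "0 \<le> t ^ 3" "0 \<le> s\<^sup>2 * t" "0 \<le> s * t\<^sup>2"
    using assms by simp_all
  ultimately show ?thesis by linarith
qed

section \<open>Existence and uniqueness of minimizers\<close>

text \<open>No midpoint value lies below the infimum, so the midpoint inequality makes a minimizing
  sequence Cauchy. Asking for it only on the sublevel set of \<open>v\<close> admits functions that
  are not globally convex.\<close>

lemma ex1_is_arg_min_midpoint_convex: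
  fixes f :: "'a::{real_inner,complete_space} \<Rightarrow> real"
  assumes cont: "\<And>x. isCont f x" and lower: "\<And>x. m \<le> f x" and "0 < \<kappa>"
    and mid: "\<And>x y. f x \<le> f v \<Longrightarrow> f y \<le> f v \<Longrightarrow>
      \<kappa> * (norm (x - y))\<^sup>2 \<le> f x + f y - 2 * f ((1/2) *\<^sub>R (x + y))"
  shows "\<exists>!u. is_arg_min f (\<lambda>_. True) u"
proof -
  define \<iota> where "\<iota> = Inf (range f)"
  have bdd: "bdd_below (range f)"
    using lower by (auto intro!: bdd_belowI)
  have inf_le: "\<iota> \<le> f x" for x
    unfolding \<iota>_def using bdd by (intro cInf_lower) auto
  \<comment> \<open>The minimizing sequence must stay in the sublevel set of \<open>v\<close>: if a
    near-minimizer \<open>y\<close> lies above it, then \<open>v\<close> itself is close enough to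
    the infimum.\<close>
  have "\<exists>x. f x \<le> f v \<and> f x < \<iota> + 1 / real (Suc n)" for n
  proof -
    have "\<iota> < \<iota> + 1 / real (Suc n)" by simp
    then obtain y where y: "f y < \<iota> + 1 / real (Suc n)"
      unfolding \<iota>_def using bdd by (subst (asm) cInf_less_iff) auto
    then show ?thesis
      by (cases "f y \<le> f v") (auto intro: exI[of _ y] exI[of _ v])
  qed
  then obtain X where Xv: "\<And>n. f (X n) \<le> f v" and Xi: "\<And>n. f (X n) < \<iota> + 1 / real (Suc n)"
    by metis
  have sq: "(norm (x - y))\<^sup>2 \<le> (f x + f y - 2 * \<iota>) / \<kappa>" if "f x \<le> f v" "f y \<le> f v" for x y
    using mid[OF that] inf_le[of "(1/2) *\<^sub>R (x + y)"] \<open>0 < \<kappa>\<close>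
    by (simp add: field_simps)
  have "Cauchy X"
    unfolding Cauchy_iff
  proof (intro allI impI)
    fix e :: real assume "0 < e"
    then obtain N where N: "1 / real (Suc N) < \<kappa> * e\<^sup>2 / 2"
      using \<open>0 < \<kappa>\<close> nat_approx_posE[of "\<kappa> * e\<^sup>2 / 2"] by auto
    have small: "f (X n) - \<iota> < \<kappa> * e\<^sup>2 / 2" if "N \<le> n" for n
    proof -
      have "1 / real (Suc n) \<le> 1 / real (Suc N)"
        using that by (intro divide_left_mono) auto
      then show ?thesis using Xi[of n] N by linarith
    qed
    have "norm (X i - X j) < e" if "N \<le> i" "N \<le> j" for i j
    proof -
      have "f (X i) + f (X j) - 2 * \<iota> < \<kappa> * e\<^sup>2"
        using small[OF that(1)] small[OF that(2)] by linarith
      then have "(f (X i) + f (X j) - 2 * \<iota>) / \<kappa> < e\<^sup>2"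
        using \<open>0 < \<kappa>\<close> by (simp add: field_simps)
      then have "(norm (X i - X j))\<^sup>2 < e\<^sup>2"
        using sq[OF Xv Xv, of i j] by linarith
      then show ?thesis
        using \<open>0 < e\<close> by (meson less_eq_real_def power_less_imp_less_base)
    qed
    then show "\<exists>M. \<forall>i\<ge>M. \<forall>j\<ge>M. norm (X i - X j) < e" by blast
  qed
  then obtain u where u: "X \<longlonglongrightarrow> u"
    by (meson Cauchy_convergent convergent_def)
  have "(\<lambda>n. f (X n)) \<longlonglongrightarrow> f u"
    using cont u by (rule isCont_tendsto_compose)
  moreover have "(\<lambda>n. \<iota> + 1 / real (Suc n)) \<longlonglongrightarrow> \<iota> + 0"
    by (intro tendsto_intros LIMSEQ_Suc[OF lim_1_over_n])
  ultimately have "f u \<le> \<iota>"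
    using Xi by (intro LIMSEQ_le[of _ "f u" _ \<iota>]) (auto intro!: exI[of _ 0] less_imp_le)
  then have u_min: "f u = \<iota>" using inf_le[of u] by linarith
  have "is_arg_min f (\<lambda>_. True) u"
    using inf_le u_min by (simp add: is_arg_min_linorder)
  moreover have "y = u" if "is_arg_min f (\<lambda>_. True) y" for y
  proof -
    have "f y \<le> f z" for z using that by (simp add: is_arg_min_linorder)
    then have "f y = \<iota>" using u_min inf_le[of y] by (metis order_antisym)
    then have "(norm (y - u))\<^sup>2 \<le> 0"
      using sq[of y u] u_min inf_le[of v] by simp
    then show ?thesis by simp
  qed
  ultimately show ?thesis by blast
qed

section \<open>Taylor estimates and symmetry for a Lipschitz Hessian\<close>

locale lipschitz_hessian =
  fixes J :: "'a::{real_inner,complete_space} \<Rightarrow> real"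
    and J' :: "'a \<Rightarrow> 'a"
    and J'' :: "'a \<Rightarrow> 'a \<Rightarrow>\<^sub>L 'a"
    and L :: real
  assumes gradient: "\<And>x. GDERIV J x :> J' x"
    and hessian: "\<And>x. (J' has_derivative blinfun_apply (J'' x)) (at x)"
    and L_nonneg: "0 \<le> L"
    and hessian_Lipschitz: "\<And>x y. norm (J'' x - J'' y) \<le> L * norm (x - y)"
begin

lemma isCont_J: "isCont J x"
  using gradient[of x] unfolding gderiv_def by (rule has_derivative_continuous)

lemma DERIV_J_line:
  "((\<lambda>t. J (x + t *\<^sub>R h)) has_real_derivative inner (J' (x + t *\<^sub>R h)) h) (at t)"
proof -
  have "((\<lambda>t. x + t *\<^sub>R h) has_derivative (\<lambda>s. s *\<^sub>R h)) (at t)"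
    by (auto intro!: derivative_eq_intros)
  from has_derivative_compose[OF this gradient[unfolded gderiv_def]]
  show ?thesis
    unfolding has_field_derivative_def
    by (rule has_derivative_eq_rhs) (auto simp: inner_commute)
qed

lemma DERIV_J'_line:
  "((\<lambda>t. inner (J' (x + t *\<^sub>R h)) v) has_real_derivative inner (J'' (x + t *\<^sub>R h) h) v) (at t)"
proof -
  have "((\<lambda>t. x + t *\<^sub>R h) has_derivative (\<lambda>s. s *\<^sub>R h)) (at t)"
    by (auto intro!: derivative_eq_intros)
  from has_derivative_inner_left[OF has_derivative_compose[OF this hessian], of v]
  show ?thesis
    unfolding has_field_derivative_def
    by (rule has_derivative_eq_rhs) (auto simp: blinfun.scaleR_right)
qed

lemma hessian_diff_inner_le:
  "inner (J'' y h) v - inner (J'' x h) v \<le> L * norm (y - x) * norm h * norm v"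
proof -
  have "inner (J'' y h) v - inner (J'' x h) v = inner ((J'' y - J'' x) h) v"
    by (simp add: blinfun.diff_left inner_diff_left)
  also have "\<dots> \<le> norm ((J'' y - J'' x) h) * norm v"
    by (rule norm_cauchy_schwarz)
  also have "\<dots> \<le> (L * norm (y - x) * norm h) * norm v"
    by (intro mult_right_mono order_trans[OF norm_blinfun] hessian_Lipschitz) auto
  finally show ?thesis .
qed

text \<open>The Lipschitz bound makes the derivative of \<open>?g\<close> along the segment
  nonnegative; comparing \<open>?g 0\<close> with \<open>?g 1\<close> replaces the integral
  remainder.\<close>

lemma gradient_taylor_inner:
  "inner (J' (x + h)) v - inner (J' x) v - inner (J'' x h) v \<le> L / 2 * (norm h)\<^sup>2 * norm v"
proof -
  let ?g = "\<lambda>t. t * inner (J'' x h) v + t\<^sup>2 * (L / 2 * (norm h)\<^sup>2 * norm v)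
               - inner (J' (x + t *\<^sub>R h)) v"
  have "?g 0 \<le> ?g 1"
  proof (rule DERIV_nonneg_imp_nondecreasing, simp, intro exI conjI)
    fix t :: real assume t: "0 \<le> t" "t \<le> 1"
    show "(?g has_real_derivative (inner (J'' x h) v + t * (L * (norm h)\<^sup>2 * norm v)
           - inner (J'' (x + t *\<^sub>R h) h) v)) (at t)"
      by (auto intro!: derivative_eq_intros DERIV_J'_line)
    show "0 \<le> inner (J'' x h) v + t * (L * (norm h)\<^sup>2 * norm v) - inner (J'' (x + t *\<^sub>R h) h) v"
      using hessian_diff_inner_le[of "x + t *\<^sub>R h" h v x] t
      by (simp add: power2_eq_square algebra_simps)
  qed
  then show ?thesis by simp
qed

text \<open>Take the remainder itself as \<open>v\<close> in the scalar estimate and cancel one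
  factor of its norm.\<close>

lemma gradient_taylor: "norm (J' (x + h) - J' x - J'' x h) \<le> L / 2 * (norm h)\<^sup>2"
proof -
  let ?r = "J' (x + h) - J' x - J'' x h"
  have "norm ?r * norm ?r \<le> L / 2 * (norm h)\<^sup>2 * norm ?r"
    using gradient_taylor_inner[of x h ?r]
    by (simp add: inner_diff_left[symmetric] power2_norm_eq_inner[symmetric] power2_eq_square)
  then show ?thesis
    using L_nonneg by (cases "norm ?r = 0") auto
qed

lemma inner_gradient_taylor:
  "\<bar>inner (J' (x + h) - J' x - J'' x h) v\<bar> \<le> L / 2 * (norm h)\<^sup>2 * norm v"
  by (rule order_trans[OF Cauchy_Schwarz_ineq2]) (intro mult_right_mono gradient_taylor norm_ge_zero)

lemma taylor:
  "\<bar>J (x + h) - J x - inner (J' x) h - inner (J'' x h) h / 2\<bar> \<le> L / 6 * (norm h) ^ 3"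
proof -
  \<comment> \<open>The sign \<open>s\<close> covers both halves of the absolute value with a single
    monotonicity argument.\<close>
  have "s * (J (x + h) - J x - inner (J' x) h - inner (J'' x h) h / 2) \<le> L / 6 * (norm h) ^ 3"
    if s: "\<bar>s\<bar> = 1" for s
  proof -
    let ?g = "\<lambda>t. t ^ 3 * (L / 6 * (norm h) ^ 3)
               - s * (J (x + t *\<^sub>R h) - t * inner (J' x) h - t\<^sup>2 * (inner (J'' x h) h / 2))"
    have "?g 0 \<le> ?g 1"
    proof (rule DERIV_nonneg_imp_nondecreasing, simp, intro exI conjI)
      fix t :: real assume t: "0 \<le> t" "t \<le> 1"
      show "(?g has_real_derivative (t\<^sup>2 * (L / 2 * (norm h) ^ 3)
             - s * (inner (J' (x + t *\<^sub>R h)) h - inner (J' x) h - t * inner (J'' x h) h))) (at t)"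
        by (auto intro!: derivative_eq_intros DERIV_J_line)
      let ?r = "inner (J' (x + t *\<^sub>R h) - J' x - J'' x (t *\<^sub>R h)) h"
      have "s * ?r \<le> \<bar>?r\<bar>"
        using s by (metis abs_ge_self abs_mult mult_1)
      also have "\<dots> \<le> L / 2 * (norm (t *\<^sub>R h))\<^sup>2 * norm h"
        by (rule inner_gradient_taylor)
      also have "\<dots> = t\<^sup>2 * (L / 2 * (norm h) ^ 3)"
        by (simp add: power2_eq_square power3_eq_cube)
      finally show "0 \<le> t\<^sup>2 * (L / 2 * (norm h) ^ 3)
          - s * (inner (J' (x + t *\<^sub>R h)) h - inner (J' x) h - t * inner (J'' x h) h)"
        by (simp add: inner_diff_left blinfun.scaleR_right)
    qed
    then show ?thesis by (simp add: algebra_simps)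
  qed
  from this[of 1] this[of "-1"] show ?thesis by (intro abs_leI) simp_all
qed

text \<open>Both orders of differencing give the same second difference, hence the Hessian is symmetric
  up to a cubic error; rescaling removes the error.\<close>

lemma hessian_second_difference:
  "\<bar>J (x + a + b) - J (x + a) - J (x + b) + J x - inner (J'' x a) b\<bar> \<le> L * (norm a + norm b) ^ 3"
proof -
  \<comment> \<open>The second difference is the expansion in direction \<open>b\<close> at
    \<open>x + a\<close> minus the one at \<open>x\<close>; what remains are the changes of gradient
    and Hessian between these base points and two cubic remainders.\<close>
  have "\<bar>inner (J'' (x + a) b) b - inner (J'' x b) b\<bar> \<le> L * norm a * (norm b)\<^sup>2"
    using hessian_diff_inner_le[of "x + a" b b x] hessian_diff_inner_le[of x b b "x + a"]
    by (simp add: power2_eq_square abs_le_iff mult.assoc)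
  moreover have "\<bar>inner (J' (x + a)) b - inner (J' x) b - inner (J'' x a) b\<bar>
      \<le> L / 2 * (norm a)\<^sup>2 * norm b"
    using inner_gradient_taylor[of x a b] by (simp add: inner_diff_left)
  moreover note taylor[of "x + a" b] taylor[of x b]
  ultimately have "\<bar>J (x + a + b) - J (x + a) - J (x + b) + J x - inner (J'' x a) b\<bar>
      \<le> L / 2 * (norm a)\<^sup>2 * norm b + L * norm a * (norm b)\<^sup>2 / 2 + 2 * (L / 6 * norm b ^ 3)"
    by linarith
  also have "\<dots> = L * ((norm a)\<^sup>2 * norm b / 2 + norm a * (norm b)\<^sup>2 / 2 + norm b ^ 3 / 3)"
    by (simp add: algebra_simps)
  also have "\<dots> \<le> L * (norm a + norm b) ^ 3"
    using L_nonneg by (intro mult_left_mono sum_powers_le_cube) auto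
  finally show ?thesis .
qed

lemma hessian_symmetric: "inner (J'' x a) b = inner (J'' x b) a"
proof -
  define q where "q = \<bar>inner (J'' x a) b - inner (J'' x b) a\<bar>"
  define M where "M = 2 * L * (norm a + norm b) ^ 3"
  have "q \<le> t * M" if "0 < t" for t
  proof -
    have "\<bar>inner (J'' x (t *\<^sub>R a)) (t *\<^sub>R b) - inner (J'' x (t *\<^sub>R b)) (t *\<^sub>R a)\<bar>
        \<le> 2 * (L * (norm (t *\<^sub>R a) + norm (t *\<^sub>R b)) ^ 3)"
      using hessian_second_difference[of x "t *\<^sub>R a" "t *\<^sub>R b"]
        hessian_second_difference[of x "t *\<^sub>R b" "t *\<^sub>R a"]
      by (simp only: add.assoc add.commute[of "t *\<^sub>R b"] add.commute[of "norm (t *\<^sub>R b)"])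
    also have "norm (t *\<^sub>R a) + norm (t *\<^sub>R b) = t * (norm a + norm b)"
      using that by (simp add: algebra_simps)
    also have "inner (J'' x (t *\<^sub>R a)) (t *\<^sub>R b) - inner (J'' x (t *\<^sub>R b)) (t *\<^sub>R a)
        = t\<^sup>2 * (inner (J'' x a) b - inner (J'' x b) a)"
      by (simp add: blinfun.scaleR_right power2_eq_square algebra_simps)
    also have "\<bar>\<dots>\<bar> = t\<^sup>2 * q"
      by (simp add: q_def abs_mult)
    also have "2 * (L * (t * (norm a + norm b)) ^ 3) = t\<^sup>2 * (t * M)"
      by (simp add: M_def power2_eq_square power3_eq_cube algebra_simps)
    finally show ?thesis using that by simp
  qed
  then have "q \<le> 0 + e" if "0 < e" for e
  proof -
    have "0 \<le> M" unfolding M_def using L_nonneg by simp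
    \<comment> \<open>The \<open>+ 1\<close> keeps the scale \<open>t = e / (M + 1)\<close> positive
      even if \<open>M = 0\<close>.\<close>
    then have "e / (M + 1) * M \<le> e" using that by (simp add: field_simps)
    then show ?thesis
      using \<open>\<And>t. 0 < t \<Longrightarrow> q \<le> t * M\<close>[of "e / (M + 1)"] \<open>0 \<le> M\<close> that by simp
  qed
  then have "q \<le> 0" by (rule field_le_epsilon)
  then show ?thesis by (simp add: q_def)
qed

section \<open>Optimality conditions and approximate monotonicity of the gradient\<close>

lemma gradient_zero_at_minimizer:
  assumes "\<And>y. J x \<le> J y"
  shows "J' x = 0"
proof -
  have "((\<lambda>t. J (x + t *\<^sub>R J' x)) has_real_derivative inner (J' x) (J' x)) (at 0)"
    using DERIV_J_line[of x "J' x" 0] by simp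
  then have "inner (J' x) (J' x) = 0"
    by (rule DERIV_local_min[where d = 1]) (auto intro: assms)
  then show ?thesis by simp
qed

lemma hessian_nonneg_at_minimizer:
  assumes min: "\<And>y. J x \<le> J y"
  shows "0 \<le> inner (J'' x h) h"
proof (rule field_le_epsilon)
  fix e :: real assume "0 < e"
  \<comment> \<open>Pulling \<open>t^2 / 2\<close> out of the cubic Taylor remainder
    \<open>L / 6 * norm (t h)^3\<close> leaves \<open>t * M\<close>, which is at most
    \<open>e\<close> for the \<open>t\<close> chosen below.\<close>
  define M where "M = L / 3 * norm h ^ 3"
  have "0 \<le> M" unfolding M_def using L_nonneg by simp
  define t where "t = e / (M + 1)"
  have "0 < t" unfolding t_def using \<open>0 \<le> M\<close> \<open>0 < e\<close> by simp
  have "0 \<le> inner (J'' x (t *\<^sub>R h)) (t *\<^sub>R h) / 2 + L / 6 * norm (t *\<^sub>R h) ^ 3"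
    using taylor[of x "t *\<^sub>R h"] min[of "x + t *\<^sub>R h"]
    unfolding gradient_zero_at_minimizer[OF min] inner_zero_left by linarith
  also have "\<dots> = t\<^sup>2 / 2 * (inner (J'' x h) h + t * M)"
    using \<open>0 < t\<close>
    by (simp add: M_def blinfun.scaleR_right power2_eq_square power3_eq_cube algebra_simps)
  finally have "0 \<le> inner (J'' x h) h + t * M"
    using \<open>0 < t\<close> by (simp add: zero_le_mult_iff)
  moreover have "t * M \<le> e"
    unfolding t_def using \<open>0 \<le> M\<close> \<open>0 < e\<close> by (simp add: field_simps)
  ultimately show "0 \<le> inner (J'' x h) h + e" by linarith
qed

text \<open>The map \<open>J' - J'' z\<close> has derivative \<open>J'' p - J'' z\<close>, of norm
  at most \<open>L * r\<close> on the ball, so the mean value inequality makes it Lipschitz there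
  with that constant.\<close>

lemma gradient_monotone_on_ball:
  assumes "norm (x - z) \<le> r" "norm (y - z) \<le> r"
  shows "inner (J'' z (x - y)) (x - y) - L * r * (norm (x - y))\<^sup>2 \<le> inner (J' x - J' y) (x - y)"
proof -
  let ?g = "\<lambda>x. J' x - J'' z x"
  have "norm (?g x - ?g y) \<le> L * r * norm (x - y)"
  proof (rule differentiable_bound[where S = "cball z r" and f' = "\<lambda>x. blinfun_apply (J'' x - J'' z)"])
    show "(?g has_derivative blinfun_apply (J'' p - J'' z)) (at p within cball z r)" for p
      by (auto intro!: derivative_eq_intros has_derivative_at_withinI[OF hessian]
          simp: blinfun.diff_left)
    show "onorm (blinfun_apply (J'' p - J'' z)) \<le> L * r" if "p \<in> cball z r" for p
    proof -
      have "norm (J'' p - J'' z) \<le> L * norm (p - z)" by (rule hessian_Lipschitz)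
      also have "\<dots> \<le> L * r"
        using that L_nonneg by (intro mult_left_mono) (auto simp: dist_norm norm_minus_commute)
      finally show ?thesis by (simp add: norm_blinfun.rep_eq)
    qed
  qed (use assms in \<open>auto simp: dist_norm norm_minus_commute\<close>)
  then have "norm (?g x - ?g y) * norm (x - y) \<le> L * r * norm (x - y) * norm (x - y)"
    by (rule mult_right_mono) simp
  moreover have "\<bar>inner (?g x - ?g y) (x - y)\<bar> \<le> norm (?g x - ?g y) * norm (x - y)"
    by (rule Cauchy_Schwarz_ineq2)
  moreover have "inner (?g x - ?g y) (x - y) = inner (J' x - J' y) (x - y) - inner (J'' z (x - y)) (x - y)"
    by (simp add: inner_diff_left blinfun.diff_right)
  ultimately show ?thesis by (simp add: power2_eq_square)
qed

end

section \<open>The source condition and the error bound\<close>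

locale tikhonov_source = lipschitz_hessian J J' J'' L
  for J :: "'a::{real_inner,complete_space} \<Rightarrow> real" and J' J'' L +
  fixes xstar \<xi> w :: 'a
  assumes J_min: "\<And>x. J xstar \<le> J x"
    and source: "xstar - \<xi> = J'' xstar w"
    and w_small: "L * norm w < 1"
    and C0_small: "L * C0_hat L w < 2"
begin

abbreviation "A \<equiv> blinfun_apply (J'' xstar)"
abbreviation "C0 \<equiv> C0_hat L w"
abbreviation "T \<equiv> tikhonov J \<xi>"

lemmas A_symmetric = hessian_symmetric[of xstar]
lemmas A_nonneg = hessian_nonneg_at_minimizer[OF J_min]

lemma C0_nonneg: "0 \<le> C0"
  unfolding C0_hat_def using w_small L_nonneg by auto

text \<open>The source condition gives \<open>x - \<xi> = (x - xstar) + A w\<close>. Symmetry of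
  \<open>A\<close> puts the cross term into the form that will cancel the linear part of
  \<open>J' x\<close> tested with \<open>w\<close>.\<close>

lemma tikhonov_expand:
  "T \<alpha> x = J x + \<alpha> * ((norm (x - xstar))\<^sup>2 + 2 * inner (A (x - xstar)) w + (norm (A w))\<^sup>2)"
proof -
  have *: "x - \<xi> = (x - xstar) + A w"
    using source by (simp add: algebra_simps)
  have "inner (A w) (x - xstar) = inner (A (x - xstar)) w"
    by (rule A_symmetric)
  then show ?thesis
    unfolding tikhonov_def * power2_norm_eq_inner
    by (simp add: inner_add_left inner_add_right inner_commute[of "x - xstar" "A w"]
        del: add_diff_eq diff_add_eq)
qed

text \<open>Competitor for the minimality of \<open>u\<^sub>\<alpha>\<close>; the factor 2 makes the terms \<open>\<langle>A w, w\<rangle>\<close> cancel.\<close>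

definition competitor :: "real \<Rightarrow> 'a" where
  "competitor \<alpha> = xstar - (2 * \<alpha>) *\<^sub>R w"

lemma norm_le_if_below_competitor:
  assumes "0 < \<alpha>" and below: "T \<alpha> x \<le> T \<alpha> (competitor \<alpha>)"
  shows "norm (x - xstar) \<le> C0 * \<alpha>"
proof -
  define e where "e = x - xstar"
  define p where "p = norm w"
  define a where "a = inner (A w) w"
  define g where "g = inner (J' x) w"
  have grad0: "J' xstar = 0" by (rule gradient_zero_at_minimizer[OF J_min])
  let ?h = "(2 * \<alpha>) *\<^sub>R w"
  have "J (competitor \<alpha>) \<le> J xstar + 2 * \<alpha>\<^sup>2 * a + 4 / 3 * L * \<alpha> ^ 3 * p ^ 3"
    using abs_le_D1[OF taylor[of xstar "- ?h"]] \<open>0 < \<alpha>\<close>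
    by (simp add: competitor_def grad0 blinfun.minus_right blinfun.scaleR_right a_def p_def
        power2_eq_square power3_eq_cube)
  moreover have "competitor \<alpha> - xstar = - ?h" by (simp add: competitor_def)
  ultimately have "T \<alpha> (competitor \<alpha>) \<le> J xstar + 2 * \<alpha>\<^sup>2 * a + 4 / 3 * L * \<alpha> ^ 3 * p ^ 3
      + \<alpha> * (4 * \<alpha>\<^sup>2 * p\<^sup>2 - 4 * \<alpha> * a + (norm (A w))\<^sup>2)"
    unfolding tikhonov_expand[of \<alpha> "competitor \<alpha>"]
    using \<open>0 < \<alpha>\<close>
    by (simp add: blinfun.minus_right blinfun.scaleR_right a_def p_def power_mult_distrib
        right_diff_distrib distrib_left)
  \<comment> \<open>A lower bound for \<open>J x\<close>: minimality of \<open>xstar\<close> is used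
    at \<open>x + 2 \<alpha> w\<close> and expanded about \<open>x\<close>. Its linear term,
    approximated by \<open>A e\<close>, cancels the cross term of
    \<open>T \<alpha> x\<close>.\<close>
  moreover have "J xstar \<le> J x + 2 * \<alpha> * g + 2 * \<alpha>\<^sup>2 * inner (J'' x w) w + 4 / 3 * L * \<alpha> ^ 3 * p ^ 3"
    using abs_le_D1[OF taylor[of x ?h]] J_min[of "x + ?h"] \<open>0 < \<alpha>\<close>
    by (simp add: blinfun.scaleR_right p_def g_def power2_eq_square power3_eq_cube mult.assoc)
  moreover have "2 * \<alpha>\<^sup>2 * inner (J'' x w) w \<le> 2 * \<alpha>\<^sup>2 * (a + L * norm e * p\<^sup>2)"
    using hessian_diff_inner_le[of x w w xstar]
    by (intro mult_left_mono) (auto simp: a_def e_def p_def power2_eq_square mult.assoc)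
  moreover have "2 * \<alpha> * g \<le> 2 * \<alpha> * (inner (A e) w + L / 2 * (norm e)\<^sup>2 * p)"
    using abs_le_D1[OF inner_gradient_taylor[of xstar e w]] \<open>0 < \<alpha>\<close>
    by (intro mult_left_mono) (auto simp: g_def e_def p_def grad0 inner_diff_left)
  moreover have "T \<alpha> x = J x + \<alpha> * ((norm e)\<^sup>2 + 2 * inner (A e) w + (norm (A w))\<^sup>2)"
    unfolding e_def by (rule tikhonov_expand)
  \<comment> \<open>The terms in \<open>a\<close> cancel, and the two cubic remainders with factor
    4/3 add up to 8/3.\<close>
  ultimately have "\<alpha> * ((1 - L * p) * (norm e)\<^sup>2) \<le> \<alpha> * (2 * (L * p\<^sup>2 * \<alpha>) * norm e
      + (4 * p\<^sup>2 + 8 / 3 * L * p ^ 3) * \<alpha>\<^sup>2)"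
    using below by (simp add: power2_eq_square power3_eq_cube algebra_simps)
  then have "(1 - L * p) * (norm e)\<^sup>2 \<le> 2 * (L * p\<^sup>2 * \<alpha>) * norm e
      + (4 * p\<^sup>2 + 8 / 3 * L * p ^ 3) * \<alpha>\<^sup>2"
    using \<open>0 < \<alpha>\<close> by simp
  from quadratic_root_bound[OF _ \<open>0 < \<alpha>\<close> this] show ?thesis
    using w_small by (simp add: C0_hat_def e_def p_def power_mult_distrib)
qed

section \<open>Strong midpoint convexity and unique solvability\<close>

text \<open>By the parallelogram law the penalty gains \<open>2 * \<alpha> * (norm h)^2\<close> with
  \<open>h\<close> half the difference, while on the ball \<open>J\<close> loses at most
  \<open>L * C0 * \<alpha> * (norm h)^2\<close>.\<close>

lemma tikhonov_midpoint_convex: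
  assumes "0 < \<alpha>" "norm (x - xstar) \<le> C0 * \<alpha>" "norm (y - xstar) \<le> C0 * \<alpha>"
  shows "(2 - L * C0) * \<alpha> / 4 * (norm (x - y))\<^sup>2 \<le> T \<alpha> x + T \<alpha> y - 2 * T \<alpha> ((1/2) *\<^sub>R (x + y))"
proof -
  define c where "c = (1/2) *\<^sub>R (x + y)"
  define h where "h = (1/2) *\<^sub>R (x - y)"
  have x: "x = c + h" and y: "y = c - h"
    by (simp_all add: c_def h_def algebra_simps flip: scaleR_add_left)
  have ball: "norm (c + t *\<^sub>R h - xstar) \<le> C0 * \<alpha>" if "\<bar>t\<bar> \<le> 1" for t
  proof -
    have "c + t *\<^sub>R h = ((1 + t) / 2) *\<^sub>R x + ((1 - t) / 2) *\<^sub>R y"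
      by (simp add: c_def h_def algebra_simps add_divide_distrib diff_divide_distrib)
    moreover have "((1 + t) / 2) *\<^sub>R x + ((1 - t) / 2) *\<^sub>R y \<in> cball xstar (C0 * \<alpha>)"
      using assms that by (intro convexD[OF convex_cball])
        (auto simp: dist_norm norm_minus_commute field_simps)
    ultimately show ?thesis by (simp add: dist_norm norm_minus_commute)
  qed
  \<comment> \<open>Both endpoints move outwards from the midpoint; the quadratic term compensates
    the possible negative curvature, so that \<open>?g\<close> is nondecreasing.\<close>
  let ?g = "\<lambda>t. J (c + t *\<^sub>R h) + J (c + t *\<^sub>R (- h)) + t\<^sup>2 * (L * (C0 * \<alpha>) * (norm h)\<^sup>2)"
  have "?g 0 \<le> ?g 1"
  proof (rule DERIV_nonneg_imp_nondecreasing, simp, intro exI conjI)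
    fix t :: real assume t: "0 \<le> t" "t \<le> 1"
    let ?p = "c + t *\<^sub>R h" and ?m = "c + t *\<^sub>R (- h)"
    show "(?g has_real_derivative (inner (J' ?p) h + inner (J' ?m) (- h)
        + 2 * t * (L * (C0 * \<alpha>) * (norm h)\<^sup>2))) (at t)"
      by (rule derivative_eq_intros DERIV_J_line refl)+ simp
    have "norm (?p - xstar) \<le> C0 * \<alpha>" "norm (?m - xstar) \<le> C0 * \<alpha>"
      using ball[of t] ball[of "-t"] t by auto
    from gradient_monotone_on_ball[OF this]
    have "- (L * (C0 * \<alpha>) * (norm (?p - ?m))\<^sup>2) \<le> inner (J' ?p - J' ?m) (?p - ?m)"
      using A_nonneg[of "?p - ?m"] by linarith
    moreover have "?p - ?m = (2 * t) *\<^sub>R h" by (simp flip: scaleR_add_left)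
    \<comment> \<open>Monotonicity tests with \<open>?p - ?m = 2 t h\<close>, so a factor
      \<open>2 * t\<close> has to be cancelled; at \<open>t = 0\<close> both points coincide and the
      derivative vanishes.\<close>
    ultimately have "(2 * t) * 0 \<le> (2 * t) * (inner (J' ?p - J' ?m) h
        + 2 * t * (L * (C0 * \<alpha>) * (norm h)\<^sup>2))"
      by (simp add: power2_eq_square algebra_simps)
    then have "0 \<le> inner (J' ?p - J' ?m) h + 2 * t * (L * (C0 * \<alpha>) * (norm h)\<^sup>2)" if "t \<noteq> 0"
      by (rule mult_left_le_imp_le) (use t that in auto)
    then show "0 \<le> inner (J' ?p) h + inner (J' ?m) (- h) + 2 * t * (L * (C0 * \<alpha>) * (norm h)\<^sup>2)"
      by (cases "t = 0") (simp_all add: inner_diff_left)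
  qed
  then have "2 * J c \<le> J x + J y + L * (C0 * \<alpha>) * (norm h)\<^sup>2"
    by (simp add: x y)
  moreover have "\<alpha> * (norm (x - \<xi>))\<^sup>2 + \<alpha> * (norm (y - \<xi>))\<^sup>2 = 2 * (\<alpha> * (norm (c - \<xi>))\<^sup>2) + 2 * \<alpha> * (norm h)\<^sup>2"
    unfolding x y power2_norm_eq_inner by (simp add: inner_simps inner_commute algebra_simps)
  moreover have modulus: "(2 - L * C0) * \<alpha> / 4 * (norm (x - y))\<^sup>2 = 2 * \<alpha> * (norm h)\<^sup>2 - L * (C0 * \<alpha>) * (norm h)\<^sup>2"
  proof -
    have "(norm (x - y))\<^sup>2 = 4 * (norm h)\<^sup>2"
      by (simp add: h_def power_divide)
    then show ?thesis by (simp add: algebra_simps diff_divide_distrib)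
  qed
  ultimately show ?thesis
    unfolding tikhonov_def c_def[symmetric] modulus by (simp add: algebra_simps)
qed

lemma tikhonov_ex1_minimizer:
  assumes "0 < \<alpha>"
  shows "\<exists>!u. is_arg_min (T \<alpha>) (\<lambda>_. True) u"
proof (rule ex1_is_arg_min_midpoint_convex)
  show "isCont (T \<alpha>) x" for x
    unfolding tikhonov_def by (intro continuous_intros isCont_J)
  show "J xstar \<le> T \<alpha> x" for x
    using J_min[of x] assms by (simp add: tikhonov_def add_increasing2)
  show "0 < (2 - L * C0) * \<alpha> / 4"
    using C0_small assms by simp
  show "(2 - L * C0) * \<alpha> / 4 * (norm (x - y))\<^sup>2 \<le> T \<alpha> x + T \<alpha> y - 2 * T \<alpha> ((1/2) *\<^sub>R (x + y))"
    if "T \<alpha> x \<le> T \<alpha> (competitor \<alpha>)" "T \<alpha> y \<le> T \<alpha> (competitor \<alpha>)" for x y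
    using assms that by (intro tikhonov_midpoint_convex norm_le_if_below_competitor)
qed

section \<open>Dependence of the minimizer on the parameter\<close>

abbreviation "u \<equiv> tikhonov_min J \<xi>"

lemma tikhonov_min_le:
  assumes "0 < \<alpha>"
  shows "T \<alpha> (u \<alpha>) \<le> T \<alpha> x"
  using theI'[OF tikhonov_ex1_minimizer[OF assms]]
  by (simp add: tikhonov_min_def is_arg_min_linorder)

lemma tikhonov_min_error:
  assumes "0 < \<alpha>"
  shows "norm (u \<alpha> - xstar) \<le> C0 * \<alpha>"
  using assms by (intro norm_le_if_below_competitor tikhonov_min_le)

text \<open>\<open>G\<close> is the gradient of \<open>T \<alpha>\<close> at the minimizer;
  differentiating along \<open>G\<close> itself gives \<open>inner G G = 0\<close>.\<close>

lemma tikhonov_min_critical: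
  assumes "0 < \<alpha>"
  shows "J' (u \<alpha>) = - (2 * \<alpha>) *\<^sub>R (u \<alpha> - \<xi>)"
proof -
  define G where "G = J' (u \<alpha>) + (2 * \<alpha>) *\<^sub>R (u \<alpha> - \<xi>)"
  have "((\<lambda>t. J (u \<alpha> + t *\<^sub>R G) + \<alpha> * inner (u \<alpha> + t *\<^sub>R G - \<xi>) (u \<alpha> + t *\<^sub>R G - \<xi>))
      has_real_derivative inner G G) (at 0)"
  proof -
    have "((\<lambda>t. u \<alpha> + t *\<^sub>R G - \<xi>) has_derivative (\<lambda>s. s *\<^sub>R G)) (at 0)"
      by (auto intro!: derivative_eq_intros)
    from has_derivative_inner[OF this this]
    have "((\<lambda>t. inner (u \<alpha> + t *\<^sub>R G - \<xi>) (u \<alpha> + t *\<^sub>R G - \<xi>))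
        has_real_derivative 2 * inner (u \<alpha> - \<xi>) G) (at 0)"
      unfolding has_field_derivative_def
      by (rule has_derivative_eq_rhs) (auto simp: inner_commute)
    from DERIV_add[OF DERIV_J_line DERIV_cmult[OF this, of \<alpha>]]
    show ?thesis
      by (rule DERIV_cong) (simp add: G_def inner_add_left)
  qed
  then have "((\<lambda>t. T \<alpha> (u \<alpha> + t *\<^sub>R G)) has_real_derivative inner G G) (at 0)"
    by (simp add: tikhonov_def power2_norm_eq_inner)
  then have "inner G G = 0"
    by (rule DERIV_local_min[where d = 1]) (auto intro: tikhonov_min_le[OF assms])
  then show ?thesis by (simp add: G_def add_eq_0_iff)
qed

text \<open>Of the right-hand side only \<open>\<langle>A w, d\<rangle>\<close> is not small; it is absorbed by \<open>\<langle>A d, d\<rangle>\<close> on the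
  left because \<open>A\<close> is positive semidefinite at \<open>(\<alpha> - \<beta>) w + d\<close>.\<close>

lemma tikhonov_min_diff:
  assumes "0 < \<beta>" "\<beta> < \<alpha>"
  defines "k \<equiv> 2 - L * C0"
  shows "(norm (u \<alpha> - u \<beta>))\<^sup>2
    \<le> (\<alpha> - \<beta>)\<^sup>2 * (2 * inner (A w) w / (k * \<alpha>) + 4 * C0\<^sup>2 / k\<^sup>2)"
proof -
  define d where "d = u \<alpha> - u \<beta>"
  define n where "n = norm d"
  define \<delta> where "\<delta> = \<alpha> - \<beta>"
  define a where "a = inner (A w) w"
  define b where "b = inner (A d) d"
  have pos: "0 < \<alpha>" "0 < k" "0 < \<delta>" using assms C0_small by (auto simp: \<delta>_def)
  \<comment> \<open>Since \<open>\<beta> < \<alpha>\<close>, the ball for \<open>\<alpha>\<close>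
    contains both minimizers, so the monotonicity estimate applies to the pair.\<close>
  have ball: "norm (u \<alpha> - xstar) \<le> C0 * \<alpha>" "norm (u \<beta> - xstar) \<le> C0 * \<alpha>"
    using tikhonov_min_error[of \<alpha>] tikhonov_min_error[of \<beta>] assms C0_nonneg pos
    by (auto intro!: order_trans[of _ "C0 * \<beta>" "C0 * \<alpha>"] mult_left_mono)
  have J'_diff: "J' (u \<alpha>) - J' (u \<beta>) = - ((2 * \<alpha>) *\<^sub>R d) - (2 * \<delta>) *\<^sub>R ((u \<beta> - xstar) + A w)"
    unfolding tikhonov_min_critical[OF \<open>0 < \<alpha>\<close>] tikhonov_min_critical[OF \<open>0 < \<beta>\<close>]
    by (simp add: source[symmetric] d_def \<delta>_def algebra_simps)
  have "inner (J' (u \<alpha>) - J' (u \<beta>)) d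
      = - (2 * \<alpha> * n\<^sup>2) - 2 * \<delta> * (inner (u \<beta> - xstar) d + inner (A w) d)"
    unfolding J'_diff by (simp add: inner_diff_left inner_add_left n_def power2_norm_eq_inner)
  with gradient_monotone_on_ball[OF ball]
  have main: "b + k * \<alpha> * n\<^sup>2 \<le> - (2 * \<delta>) * (inner (u \<beta> - xstar) d + inner (A w) d)"
    by (simp add: b_def d_def[symmetric] n_def[symmetric] k_def algebra_simps)
  have "- (2 * \<delta>) * inner (u \<beta> - xstar) d \<le> 2 * \<delta> * (C0 * \<alpha> * n)"
  proof -
    have "\<bar>inner (u \<beta> - xstar) d\<bar> \<le> norm (u \<beta> - xstar) * norm d"
      by (rule Cauchy_Schwarz_ineq2)
    also have "\<dots> \<le> C0 * \<alpha> * n"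
      unfolding n_def by (intro mult_right_mono ball) simp
    finally have "2 * \<delta> * (- inner (u \<beta> - xstar) d) \<le> 2 * \<delta> * (C0 * \<alpha> * n)"
      using pos by (intro mult_left_mono abs_le_D2) auto
    then show ?thesis by (simp only: mult_minus_left mult_minus_right)
  qed
  moreover have "- (2 * \<delta>) * inner (A w) d \<le> \<delta>\<^sup>2 * a + b"
  proof -
    have "0 \<le> inner (A (\<delta> *\<^sub>R w + d)) (\<delta> *\<^sub>R w + d)" by (rule A_nonneg)
    also have "\<dots> = \<delta>\<^sup>2 * a + b + 2 * \<delta> * inner (A w) d"
      using A_symmetric[of d w]
      by (simp add: a_def b_def blinfun.add_right blinfun.scaleR_right inner_simps
          power2_eq_square algebra_simps)
    finally show ?thesis by simp
  qed
  ultimately have "k * \<alpha> * n\<^sup>2 \<le> \<delta>\<^sup>2 * a + 2 * \<delta> * (C0 * \<alpha> * n)"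
    using main by (simp add: algebra_simps)
  then have "n\<^sup>2 \<le> \<delta>\<^sup>2 * a / (k * \<alpha>) + 2 * (\<delta> * C0 / k) * n"
    using pos by (simp add: field_simps)
  \<comment> \<open>Young's inequality absorbs the term linear in \<open>n\<close> into half of
    \<open>n^2\<close>.\<close>
  moreover have "2 * z * n \<le> n\<^sup>2 / 2 + 2 * z\<^sup>2" for z
    using zero_le_power2[of "n - 2 * z"]
    by (simp add: power2_eq_square algebra_simps)
  note this[of "\<delta> * C0 / k"]
  ultimately have "n\<^sup>2 \<le> 2 * (\<delta>\<^sup>2 * a / (k * \<alpha>)) + 4 * (\<delta> * C0 / k)\<^sup>2"
    by linarith
  also have "\<dots> = \<delta>\<^sup>2 * (2 * a / (k * \<alpha>) + 4 * C0\<^sup>2 / k\<^sup>2)"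
    by (simp add: power_divide power_mult_distrib algebra_simps)
  finally show ?thesis by (simp add: n_def d_def \<delta>_def a_def)
qed

end

section \<open>A constant uniform in 0 < \<beta> < \<alpha> \<le> \<alpha>bar\<close>

theorem lemma3p1:
  fixes J :: "'a::{real_inner,complete_space} \<Rightarrow> real"
    and J' :: "'a \<Rightarrow> 'a"
    and J'' :: "'a \<Rightarrow> 'a \<Rightarrow>\<^sub>L 'a"
    and xstar \<xi> w :: 'a
    and L \<alpha>bar :: real
  assumes gradient: "\<And>x. GDERIV J x :> J' x"
    and hessian: "\<And>x. (J' has_derivative blinfun_apply (J'' x)) (at x)"
    and hessian_continuous: "continuous_on UNIV J''"
    and minimizer: "is_arg_min J (\<lambda>_. True) xstar"
    and L_pos: "L > 0"
    and hessian_Lipschitz: "\<And>x y. norm (J'' x - J'' y) \<le> L * norm (x - y)"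
    and source_condition: "xstar - \<xi> = J'' xstar w"
    and w_small: "L * norm w < 1"
    and C0_small: "L * C0_hat L w < 2"
    and \<alpha>bar_pos: "\<alpha>bar > 0"
  shows "\<exists>C3\<ge>0. \<forall>\<alpha> \<beta>. 0 < \<beta> \<and> \<beta> < \<alpha> \<and> \<alpha> \<le> \<alpha>bar \<longrightarrow>
           norm (tikhonov_min J \<xi> \<alpha> - tikhonov_min J \<xi> \<beta>) \<le> C3 * ((\<alpha> - \<beta>) / sqrt \<alpha>)"
proof -
  interpret tikhonov_source J J' J'' L xstar \<xi> w
    using assms by unfold_locales (auto simp: is_arg_min_linorder)
  define k where "k = 2 - L * C0"
  define a where "a = inner (A w) w"
  \<comment> \<open>\<open>C\<close> bounds \<alpha> times the bracket of the difference estimate: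
    the first summand loses its 1/\<alpha>, the second gains a factor \<alpha>, at most \<alpha>bar.
    The square root of \<open>C\<close> is the required constant.\<close>
  define C where "C = 2 * a / k + 4 * C0\<^sup>2 / k\<^sup>2 * \<alpha>bar"
  have "0 < k" "0 \<le> a" using C0_small A_nonneg by (auto simp: k_def a_def)
  show ?thesis
  proof (intro exI conjI allI impI)
    show "0 \<le> sqrt C"
      unfolding C_def using \<open>0 < k\<close> \<open>0 \<le> a\<close> \<alpha>bar_pos by simp
    fix \<alpha> \<beta> :: real assume "0 < \<beta> \<and> \<beta> < \<alpha> \<and> \<alpha> \<le> \<alpha>bar"
    then have *: "0 < \<beta>" "\<beta> < \<alpha>" "\<alpha> \<le> \<alpha>bar" "0 < \<alpha>" by auto
    have "2 * a / (k * \<alpha>) + 4 * C0\<^sup>2 / k\<^sup>2 = (2 * a / k + 4 * C0\<^sup>2 / k\<^sup>2 * \<alpha>) / \<alpha>"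
      using * by (simp add: add_divide_distrib)
    also have "\<dots> \<le> C / \<alpha>"
      unfolding C_def using * by (intro divide_right_mono add_left_mono mult_left_mono) auto
    finally have "(\<alpha> - \<beta>)\<^sup>2 * (2 * a / (k * \<alpha>) + 4 * C0\<^sup>2 / k\<^sup>2) \<le> (\<alpha> - \<beta>)\<^sup>2 * (C / \<alpha>)"
      by (intro mult_left_mono) auto
    with tikhonov_min_diff[OF *(1,2)]
    have "(norm (u \<alpha> - u \<beta>))\<^sup>2 \<le> (\<alpha> - \<beta>)\<^sup>2 * (C / \<alpha>)"
      by (simp add: k_def a_def)
    then have "norm (u \<alpha> - u \<beta>) \<le> sqrt ((\<alpha> - \<beta>)\<^sup>2 * (C / \<alpha>))"
      by (rule real_le_rsqrt)
    also have "\<dots> = sqrt C * ((\<alpha> - \<beta>) / sqrt \<alpha>)"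
      using * by (simp add: real_sqrt_mult real_sqrt_divide)
    finally show "norm (u \<alpha> - u \<beta>) \<le> sqrt C * ((\<alpha> - \<beta>) / sqrt \<alpha>)" .
  qed
qed

end
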